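(* Let $n \ge 2$ and let $0 \le p_1 < p_2 < \cdots < p_n \le 1$ be the blue-fractions of $n$ bichromatic urns (urn $i$ has a fraction $p_i$ of blue balls and $1-p_i$ of red balls), and let $\epsilon = \min_{1 \le i \le n-1}(p_{i+1}-p_i)$. Then for Cumulative Voting there is a voting scheme for which, for every $\eta\in(0,1)$, $O\left(\epsilon^{-2}\ln\frac{1}{\eta}\right)$ voters (absolute implicit constant) are sufficient to guarantee, whichever urn is the correct one, a probability of at least $1-\eta$ that the correct urn wins the election.
   Context: Voting model: one urn is chosen (adversarially) as the correct urn. Each of $m$ voters independently draws one ball (with replacement) from it and observes only its color. In Cumulative Voting, each voter assigns to each urn a nonnegative score, with the scores assigned by one voter summing to $1$; the assignment is a function (possibly randomized, with independent randomness across voters) of the observed color, and the voting scheme specifying it may depend on $p_1,\dots,p_n$ but not on which urn is correct. The total score of an urn is the sum of the scores assigned to it by all voters; an urn wins the election if its total score is strictly larger than the total score of every other urn. *)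

theory Defs
  imports "HOL-Probability.Probability"
begin

text \<open>The urns are \<open>1, \<dots>, n\<close>. A ballot is the vector of scores that one voter assigns to them.\<close>

definition ballots :: "nat \<Rightarrow> (nat \<Rightarrow> real) set" where
  "ballots n = {s \<in> extensional {1..n}. (\<forall>i\<in>{1..n}. 0 \<le> s i) \<and> (\<Sum>i=1..n. s i) = 1}"

definition ballot_space :: "nat \<Rightarrow> (nat \<Rightarrow> real) measure" where
  "ballot_space n = restrict_space (\<Pi>\<^sub>M i\<in>{1..n}. borel) (ballots n)"

text \<open>A randomized scheme is a map from the observed color to the law of the resulting ballot;
  \<open>True\<close> stands for blue. Deterministic schemes are those whose laws are point masses.\<close>

definition cumulative_voting_scheme :: "nat \<Rightarrow> (bool \<Rightarrow> (nat \<Rightarrow> real) measure) \<Rightarrow> bool" where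
  "cumulative_voting_scheme n S \<longleftrightarrow>
     (\<forall>c. prob_space (S c) \<and> sets (S c) = sets (ballot_space n))"

text \<open>The law of a single ballot when the correct urn has blue-fraction \<open>q \<in> [0,1]\<close>.\<close>

definition vote :: "(bool \<Rightarrow> (nat \<Rightarrow> real) measure) \<Rightarrow> real \<Rightarrow> (nat \<Rightarrow> real) measure" where
  "vote S q = measure_pmf (bernoulli_pmf q) \<bind> S"

definition election ::
    "nat \<Rightarrow> (bool \<Rightarrow> (nat \<Rightarrow> real) measure) \<Rightarrow> real \<Rightarrow> (nat \<Rightarrow> nat \<Rightarrow> real) measure" where
  "election m S q = (\<Pi>\<^sub>M v\<in>{..<m}. vote S q)"

definition total_score :: "nat \<Rightarrow> (nat \<Rightarrow> nat \<Rightarrow> real) \<Rightarrow> nat \<Rightarrow> real" where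
  "total_score m b i = (\<Sum>v<m. b v i)"

definition wins :: "nat \<Rightarrow> nat \<Rightarrow> (nat \<Rightarrow> nat \<Rightarrow> real) \<Rightarrow> nat \<Rightarrow> bool" where
  "wins n m b i \<longleftrightarrow> (\<forall>j\<in>{1..n} - {i}. total_score m b j < total_score m b i)"

definition win_prob ::
    "nat \<Rightarrow> nat \<Rightarrow> (bool \<Rightarrow> (nat \<Rightarrow> real) measure) \<Rightarrow> (nat \<Rightarrow> real) \<Rightarrow> nat \<Rightarrow> real" where
  "win_prob n m S p i =
     measure (election m S (p i)) {b \<in> space (election m S (p i)). wins n m b i}"

definition min_gap :: "nat \<Rightarrow> (nat \<Rightarrow> real) \<Rightarrow> real" where
  "min_gap n p = Min ((\<lambda>i. p (i + 1) - p i) ` {1..n - 1})"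

end

theory Submission
  imports Defs
begin

text \<open>
  A voter turns the color into the number \<open>X = [blue] + V\<close> with \<open>V\<close> independent mean-zero noise,
  and scores the urns so that the winner is the urn whose fraction is nearest to the mean of the
  \<open>X\<close>. Hence urn \<open>i\<close> wins if the sum of the \<open>X\<close> is within \<open>m\<epsilon>/2\<close> of \<open>m p\<^sub>i\<close>.

  When \<open>m\<epsilon>\<^sup>2\<close> is large, this follows from Hoeffding's inequality. The bound must however hold for
  every \<open>\<eta> < 1\<close>, so when \<open>m\<epsilon>\<^sup>2\<close> is bounded every urn still needs a winning probability of
  order \<open>m\<epsilon>\<^sup>2\<close>. No deterministic scheme provides this: with one voter and \<open>n \<ge> 3\<close> some urn
  cannot win at all. The noise is zero with probability \<open>1 - \<epsilon>/16\<close> and otherwise uniform on a fine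
  grid of \<open>[-1,1]\<close>. If \<open>m\<epsilon> \<ge> 8\<close>, the total noise is below \<open>m\<epsilon>/4\<close> with probability \<open>3/4\<close> by
  Markov's inequality, and unimodality of the number of blue draws together with its concentration
  on the scale \<open>\<surd>m\<close> gives it a chance of order \<open>\<surd>m\<epsilon>\<close> to be within \<open>m\<epsilon>/4\<close> of its mean.
  If \<open>m\<epsilon> \<le> 8\<close>, the blue draws hit their mode, which is within 1 of the mean, and exactly one
  voter is noisy and corrects the difference up to \<open>m\<epsilon>/2\<close>.
\<close>

section \<open>Unimodality of the binomial distribution\<close>

text \<open>The ratio of consecutive binomial weights, cross-multiplied so that it also holds for
  \<open>q = 0\<close> and \<open>q = 1\<close>.\<close>

lemma pmf_binomial_Suc_ratio:
  assumes q: "q \<in> {0..1}" and k: "k < m"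
  shows "pmf (binomial_pmf m q) (Suc k) * (real (Suc k) * (1 - q)) =
         pmf (binomial_pmf m q) k * (real (m - k) * q)"
proof -
  have c: "real (m choose Suc k) * real (Suc k) = real (m choose k) * real (m - k)"
  proof -
    have "Suc k * (m choose Suc k) = m * ((m - 1) choose k)"
      using binomial_absorption[of k m] .
    moreover have "(m - k) * (m choose k) = m * ((m - 1) choose k)"
      using binomial_absorb_comp[of m k] .
    ultimately have "(m choose Suc k) * Suc k = (m choose k) * (m - k)"
      by (simp add: mult.commute)
    then show ?thesis by (metis of_nat_mult)
  qed
  have e: "m - k = Suc (m - Suc k)" using k by simp
  have "pmf (binomial_pmf m q) (Suc k) * (real (Suc k) * (1 - q)) =
        (real (m choose Suc k) * real (Suc k)) * (q * q ^ k * ((1 - q) ^ (m - Suc k) * (1 - q)))"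
    using q by (simp add: pmf_binomial algebra_simps)
  also have "\<dots> = pmf (binomial_pmf m q) k * (real (m - k) * q)"
    unfolding c using q by (simp add: pmf_binomial e algebra_simps)
  finally show ?thesis .
qed

text \<open>For \<open>q\<close> in the unit interval, the cap at \<open>m\<close> takes effect only
  for \<open>q = 1\<close>, where the floor is \<open>m + 1\<close>.\<close>

definition binomial_mode :: "nat \<Rightarrow> real \<Rightarrow> nat" where
  "binomial_mode m q = min m (nat \<lfloor>real (m + 1) * q\<rfloor>)"

lemma binomial_mode_near_mean:
  assumes "q \<in> {0..1}"
  shows "\<bar>real (binomial_mode m q) - m * q\<bar> \<le> 1"
proof -
  have n: "0 \<le> real (m + 1) * q" "q * m \<le> m" using assms by (auto simp: mult_left_le_one_le)
  have f: "real (nat \<lfloor>real (m + 1) * q\<rfloor>) = of_int \<lfloor>real (m + 1) * q\<rfloor>"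
    using n by (simp add: of_nat_nat)
  have "of_int \<lfloor>real (m + 1) * q\<rfloor> \<le> real (m + 1) * q"
       "real (m + 1) * q < of_int \<lfloor>real (m + 1) * q\<rfloor> + 1" by linarith+
  with f have F: "real (nat \<lfloor>real (m + 1) * q\<rfloor>) \<le> m * q + q"
     "m * q + q < real (nat \<lfloor>real (m + 1) * q\<rfloor>) + 1" by (auto simp: algebra_simps)
  show ?thesis
  proof (cases "m \<le> nat \<lfloor>real (m + 1) * q\<rfloor>")
    case True
    then have "real m \<le> m * q + q" using F(1) by linarith
    then show ?thesis using True assms n by (simp add: binomial_mode_def mult.commute)
  next
    case False
    then show ?thesis using F assms by (auto simp: binomial_mode_def min_def)
  qed
qed

text \<open>Below the mode, \<open>k + 1 \<le> (m + 1) * q\<close>, which rearranges to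
  \<open>(k + 1) * (1 - q) \<le> (m - k) * q\<close>; by the ratio formula the weights do not
  decrease there.\<close>

lemma pmf_binomial_le_Suc:
  assumes q: "q \<in> {0..1}" and k: "k < binomial_mode m q"
  shows "pmf (binomial_pmf m q) k \<le> pmf (binomial_pmf m q) (Suc k)"
proof -
  have km: "k < m" and k2: "Suc k \<le> nat \<lfloor>real (m + 1) * q\<rfloor>"
    using k by (auto simp: binomial_mode_def)
  have "real (Suc k) \<le> real (m + 1) * q"
    using k2 by linarith
  then have le: "real (Suc k) * (1 - q) \<le> real (m - k) * q"
    using km by (simp add: algebra_simps of_nat_diff)
  show ?thesis
  proof (cases "q = 1")
    \<comment> \<open>The factor \<open>1 - q\<close> cannot be cancelled here, but all mass sits at
      \<open>m\<close>, so the weight at \<open>k < m\<close> is zero.\<close>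
    case True
    then show ?thesis using km by (simp add: power_0_left)
  next
    case False
    then have pos: "0 < real (Suc k) * (1 - q)" using q by simp
    have "pmf (binomial_pmf m q) k * (real (Suc k) * (1 - q)) \<le>
          pmf (binomial_pmf m q) k * (real (m - k) * q)"
      using le by (intro mult_left_mono) auto
    also have "\<dots> = pmf (binomial_pmf m q) (Suc k) * (real (Suc k) * (1 - q))"
      using pmf_binomial_Suc_ratio[OF q km] by simp
    finally show ?thesis using pos by (meson mult_le_cancel_right_pos)
  qed
qed

lemma pmf_binomial_Suc_le:
  assumes q: "q \<in> {0..1}" and k: "binomial_mode m q \<le> k"
  shows "pmf (binomial_pmf m q) (Suc k) \<le> pmf (binomial_pmf m q) k"
proof (cases "k < m")
  case False
  then have "pmf (binomial_pmf m q) (Suc k) = 0" using q by (simp add: binomial_eq_0)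
  then show ?thesis by (metis pmf_nonneg)
next
  case km: True
  then have "nat \<lfloor>real (m + 1) * q\<rfloor> \<le> k"
    using k by (auto simp: binomial_mode_def)
  then have lt: "real (m + 1) * q < real (Suc k)"
    by linarith
  then have le: "real (m - k) * q \<le> real (Suc k) * (1 - q)"
    using km by (simp add: algebra_simps of_nat_diff)
  have "q \<noteq> 1" using lt km by auto
  then have pos: "0 < real (Suc k) * (1 - q)" using q by simp
  have "pmf (binomial_pmf m q) (Suc k) * (real (Suc k) * (1 - q)) =
        pmf (binomial_pmf m q) k * (real (m - k) * q)"
    using pmf_binomial_Suc_ratio[OF q km] .
  also have "\<dots> \<le> pmf (binomial_pmf m q) k * (real (Suc k) * (1 - q))"
    using le by (intro mult_left_mono) auto
  finally show ?thesis using pos by (meson mult_le_cancel_right_pos)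
qed

text \<open>Every term from index \<open>L\<close> on is at most \<open>g L\<close>, hence at most
  the average of the first \<open>L\<close> terms; at most \<open>R\<close> such terms are added to
  the initial block.\<close>

lemma sum_decreasing_le:
  fixes g :: "nat \<Rightarrow> real"
  assumes dec: "\<And>k. g (Suc k) \<le> g k" and nn: "\<And>k. 0 \<le> g k" and L: "0 < L"
    and D: "real R \<le> D"
  shows "(\<Sum>k<R. g k) \<le> (\<Sum>k<L. g k) * (1 + D / L)"
proof -
  have mono: "g j \<le> g i" if "i \<le> j" for i j
    using that dec by (rule lift_Suc_antimono_le[rotated])
  have A: "real L * g L \<le> (\<Sum>k<L. g k)"
    using sum_mono[of "{..<L}" "\<lambda>_. g L" g] mono by simp
  have "(\<Sum>k<R. g k) \<le> (\<Sum>k<L + R. g k)"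
    by (intro sum_mono2) (auto simp: nn)
  also have "\<dots> = (\<Sum>k<L. g k) + (\<Sum>k\<in>{L..<L + R}. g k)"
    by (simp add: lessThan_atLeast0 sum.atLeastLessThan_concat)
  also have "(\<Sum>k\<in>{L..<L + R}. g k) \<le> real R * g L"
    using sum_mono[of "{L..<L + R}" g "\<lambda>_. g L"] mono by simp
  also have "\<dots> \<le> D * ((\<Sum>k<L. g k) / L)"
    using A L D nn by (intro mult_mono) (auto simp: field_simps)
  finally show ?thesis by (simp add: field_simps)
qed

text \<open>Both branches of the distribution decrease away from the mode, so
  \<open>sum_decreasing_le\<close> applies to each. The factor 2 comes from bounding each branch by
  the whole window, and \<open>D + 1\<close> from rounding \<open>D\<close> up.\<close>

lemma prob_unimodal_near_mode:
  fixes P :: "nat pmf" and M L :: nat and D :: real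
  assumes inc: "\<And>k. k < M \<Longrightarrow> pmf P k \<le> pmf P (Suc k)"
    and dec: "\<And>k. M \<le> k \<Longrightarrow> pmf P (Suc k) \<le> pmf P k"
    and L: "0 < L" and D: "0 \<le> D"
  shows "measure_pmf.prob P {k. \<bar>real k - M\<bar> < D} \<le>
         2 * measure_pmf.prob P {k. \<bar>real k - M\<bar> < L} * (1 + (D + 1) / L)"
proof -
  define R where "R = nat \<lceil>D\<rceil>"
  have R: "real R \<le> D + 1" "D \<le> real R" using D unfolding R_def by linarith+
  define r where "r k = pmf P (M + k)" for k
  \<comment> \<open>Zero beyond index \<open>M\<close> keeps the left branch an infinite decreasing
    sequence.\<close>
  define l where "l k = (if k \<le> M then pmf P (M - k) else 0)" for k
  have r: "(\<Sum>k<R. r k) \<le> (\<Sum>k<L. r k) * (1 + (D + 1) / L)"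
    using dec L R by (intro sum_decreasing_le) (auto simp: r_def)
  have "pmf P (M - Suc k) \<le> pmf P (M - k)" if "Suc k \<le> M" for k
    using inc[of "M - Suc k"] that by (simp add: Suc_diff_Suc)
  then have l: "(\<Sum>k<R. l k) \<le> (\<Sum>k<L. l k) * (1 + (D + 1) / L)"
    using L R by (intro sum_decreasing_le) (auto simp: l_def)
  have rs: "(\<Sum>k<N. r k) = measure_pmf.prob P {M..<M + N}" for N
  proof -
    have "(\<Sum>k<N. r k) = sum (pmf P) {M..<M + N}"
      unfolding r_def
      by (rule sum.reindex_bij_witness[of _ "\<lambda>k. k - M" "\<lambda>k. M + k"]) auto
    then show ?thesis by (simp add: measure_measure_pmf_finite)
  qed
  have ls: "(\<Sum>k<N. l k) = measure_pmf.prob P {k. k \<le> M \<and> M < k + N}" for N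
  proof -
    have "(\<Sum>k<N. l k) = (\<Sum>k\<in>{k. k < N \<and> k \<le> M}. l k)"
      by (rule sum.mono_neutral_right) (auto simp: l_def)
    also have "\<dots> = sum (pmf P) {k. k \<le> M \<and> M < k + N}"
      unfolding l_def
      by (rule sum.reindex_bij_witness[of _ "\<lambda>k. M - k" "\<lambda>k. M - k"]) auto
    finally show ?thesis by (simp add: measure_measure_pmf_finite)
  qed
  have "measure_pmf.prob P {k. \<bar>real k - M\<bar> < D} \<le>
        measure_pmf.prob P ({M..<M + R} \<union> {k. k \<le> M \<and> M < k + R})"
  proof (rule measure_pmf.finite_measure_mono)
    have "k \<in> {M..<M + R} \<union> {k. k \<le> M \<and> M < k + R}" if "\<bar>real k - M\<bar> < D" for k
    proof -
      have "\<bar>real k - M\<bar> < R" using that R by linarith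
      then show ?thesis by auto
    qed
    then show "{k. \<bar>real k - M\<bar> < D} \<subseteq> {M..<M + R} \<union> {k. k \<le> M \<and> M < k + R}" by blast
  qed auto
  also have "\<dots> \<le> (\<Sum>k<R. r k) + (\<Sum>k<R. l k)"
    unfolding rs ls by (rule measure_Un_le) auto
  also have "\<dots> \<le> (measure_pmf.prob P {M..<M + L} + measure_pmf.prob P {k. k \<le> M \<and> M < k + L})
      * (1 + (D + 1) / L)"
    using r l unfolding rs ls by (simp add: algebra_simps)
  also have "\<dots> \<le> (2 * measure_pmf.prob P {k. \<bar>real k - M\<bar> < L}) * (1 + (D + 1) / L)"
  proof (rule mult_right_mono)
    have "measure_pmf.prob P {M..<M + L} \<le> measure_pmf.prob P {k. \<bar>real k - M\<bar> < L}"
      by (rule measure_pmf.finite_measure_mono) (auto simp: abs_if)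
    moreover have "measure_pmf.prob P {k. k \<le> M \<and> M < k + L} \<le> measure_pmf.prob P {k. \<bar>real k - M\<bar> < L}"
      by (rule measure_pmf.finite_measure_mono) (auto simp: abs_if)
    ultimately show "measure_pmf.prob P {M..<M + L} + measure_pmf.prob P {k. k \<le> M \<and> M < k + L}
      \<le> 2 * measure_pmf.prob P {k. \<bar>real k - M\<bar> < L}" by simp
  qed (use D in auto)
  finally show ?thesis .
qed

text \<open>Hoeffding's inequality with deviation \<open>sqrt m\<close> leaves mass at least 1/2
  within \<open>sqrt m\<close> of the mean, hence within \<open>sqrt m + 1\<close> of the mode.
  Unimodality guarantees the inner window its proportional share, up to a constant.\<close>

lemma prob_binomial_near_mode:
  fixes m L :: nat
  assumes q: "q \<in> {0..1}" and m: "0 < m" and L: "0 < L"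
  shows "real L / (4 * (L + sqrt m + 2)) \<le>
         measure_pmf.prob (binomial_pmf m q) {k. \<bar>real k - binomial_mode m q\<bar> < L}"
proof -
  let ?P = "binomial_pmf m q" and ?M = "binomial_mode m q"
  interpret binomial_distribution m q by standard fact
  have e: "2 * exp (-2) \<le> (1::real) / 2"
  proof -
    have "(2::real) ^ 2 \<le> exp 1 ^ 2" using exp_ge_add_one_self[of 1] by (intro power_mono) auto
    also have "exp 1 ^ 2 = exp (2::real)" by (simp add: exp_of_nat_mult[symmetric])
    finally show ?thesis by (simp add: exp_minus field_simps)
  qed
  have "measure_pmf.prob ?P {k. sqrt m \<le> \<bar>real k - m * q\<bar>} \<le> 2 * exp (-2)"
    using prob_abs_ge[OF m, of "sqrt m"] m by simp
  then have "1 / 2 \<le> 1 - measure_pmf.prob ?P {k. sqrt m \<le> \<bar>real k - m * q\<bar>}"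
    using e by simp
  also have "\<dots> = measure_pmf.prob ?P (- {k. sqrt m \<le> \<bar>real k - m * q\<bar>})"
    using measure_pmf.prob_compl[of "{k. sqrt m \<le> \<bar>real k - m * q\<bar>}" ?P]
    by (simp add: Compl_eq_Diff_UNIV)
  also have "\<dots> \<le> measure_pmf.prob ?P {k. \<bar>real k - ?M\<bar> < sqrt m + 1}"
    using binomial_mode_near_mean[OF q, of m]
    by (intro measure_pmf.finite_measure_mono) auto
  also have "\<dots> \<le> 2 * measure_pmf.prob ?P {k. \<bar>real k - ?M\<bar> < L} * (1 + (sqrt m + 1 + 1) / L)"
    by (rule prob_unimodal_near_mode)
       (use q L in \<open>simp_all del: pmf_binomial add: pmf_binomial_le_Suc pmf_binomial_Suc_le\<close>)
  also have "\<dots> = 2 * measure_pmf.prob ?P {k. \<bar>real k - ?M\<bar> < L} * ((L + sqrt m + 2) / L)"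
    using L by (simp add: field_simps)
  finally show ?thesis using L
    by (simp add: field_simps add_pos_nonneg)
qed

section \<open>Sums of independent real random variables\<close>

text \<open>Convolution, the law of a sum of independent variables; \<open>sum_pmf\<close> is the
  convolution power.\<close>

definition add_pmf :: "real pmf \<Rightarrow> real pmf \<Rightarrow> real pmf" where
  "add_pmf P Q = bind_pmf P (\<lambda>x. map_pmf (\<lambda>y. x + y) Q)"

primrec sum_pmf :: "nat \<Rightarrow> real pmf \<Rightarrow> real pmf" where
  "sum_pmf 0 P = return_pmf 0"
| "sum_pmf (Suc m) P = add_pmf P (sum_pmf m P)"

lemma add_pmf_assoc: "add_pmf (add_pmf P Q) R = add_pmf P (add_pmf Q R)"
  by (simp add: add_pmf_def map_pmf_def bind_assoc_pmf bind_return_pmf add.assoc)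

lemma add_pmf_commute: "add_pmf P Q = add_pmf Q P"
  unfolding add_pmf_def map_pmf_def by (subst bind_commute_pmf) (simp add: add.commute)

text \<open>Separates the total of the blue draws from the total noise, so that the two can be
  estimated independently.\<close>

lemma sum_pmf_add_pmf: "sum_pmf m (add_pmf P Q) = add_pmf (sum_pmf m P) (sum_pmf m Q)"
proof (induction m)
  case 0
  then show ?case by (simp add: add_pmf_def bind_return_pmf)
next
  case (Suc m)
  have "sum_pmf (Suc m) (add_pmf P Q) = add_pmf P (add_pmf (add_pmf Q (sum_pmf m P)) (sum_pmf m Q))"
    by (simp add: Suc add_pmf_assoc)
  also have "\<dots> = add_pmf (sum_pmf (Suc m) P) (sum_pmf (Suc m) Q)"
    by (subst add_pmf_commute[of Q]) (simp add: add_pmf_assoc)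
  finally show ?case .
qed

text \<open>Links the convolution calculus to the joint law of all voters. The default
  \<open>d\<close> is arbitrary, since only coordinates below \<open>m\<close> are summed.\<close>

lemma sum_pmf_conv_Pi_pmf:
  "sum_pmf m P = map_pmf (\<lambda>f. \<Sum>v<m. f v) (Pi_pmf {..<m} d (\<lambda>_. P))"
proof (induction m)
  case (Suc m)
  have "map_pmf (\<lambda>f. \<Sum>v<Suc m. f v) (Pi_pmf {..<Suc m} d (\<lambda>_. P)) =
    bind_pmf P (\<lambda>x. map_pmf (\<lambda>f. (\<Sum>v<Suc m. (f(m := x)) v)) (Pi_pmf {..<m} d (\<lambda>_. P)))"
    unfolding lessThan_Suc[of m]
    by (subst Pi_pmf_insert') (simp_all only: map_pmf_def bind_assoc_pmf bind_return_pmf finite_lessThan lessThan_iff less_irrefl not_False_eq_True)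
  also have "\<dots> = bind_pmf P (\<lambda>x. map_pmf (\<lambda>f. x + (\<Sum>v<m. f v)) (Pi_pmf {..<m} d (\<lambda>_. P)))"
    by (intro bind_pmf_cong refl map_pmf_cong) (auto simp: add.commute intro!: sum.cong)
  also have "\<dots> = add_pmf P (sum_pmf m P)"
    by (simp add: Suc add_pmf_def pmf.map_comp o_def)
  finally show ?case by simp
qed simp

lemma sum_pmf_bernoulli:
  assumes "q \<in> {0..1}"
  shows "sum_pmf m (map_pmf of_bool (bernoulli_pmf q)) = map_pmf real (binomial_pmf m q)"
proof (induction m)
  case 0
  then show ?case using assms by (simp add: binomial_pmf_0)
next
  case (Suc m)
  then show ?case using assms
    by (auto simp: binomial_pmf_Suc add_pmf_def map_pmf_def bind_assoc_pmf bind_return_pmf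
             intro!: bind_pmf_cong)
qed

lemma prob_add_pmf_ge:
  assumes "\<And>x y. x \<in> A \<Longrightarrow> y \<in> B \<Longrightarrow> x + y \<in> C"
  shows "measure_pmf.prob P A * measure_pmf.prob Q B \<le> measure_pmf.prob (add_pmf P Q) C"
proof -
  \<comment> \<open>Intersecting with the supports makes both sets countable, as the product rule
    requires.\<close>
  define A' B' where "A' = A \<inter> set_pmf P" and "B' = B \<inter> set_pmf Q"
  have "measure_pmf.prob P A * measure_pmf.prob Q B = measure_pmf.prob P A' * measure_pmf.prob Q B'"
    by (simp add: A'_def B'_def measure_Int_set_pmf)
  also have "\<dots> = measure_pmf.prob (pair_pmf P Q) (A' \<times> B')"
    by (rule measure_pmf_prob_product[symmetric]) (auto simp: A'_def B'_def)
  also have "\<dots> \<le> measure_pmf.prob (pair_pmf P Q) ((\<lambda>(x, y). x + y) -` C)"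
    using assms by (intro measure_pmf.finite_measure_mono) (auto simp: A'_def B'_def)
  also have "\<dots> = measure_pmf.prob (map_pmf (\<lambda>(x, y). x + y) (pair_pmf P Q)) C" by simp
  also have "map_pmf (\<lambda>(x, y). x + y) (pair_pmf P Q) = add_pmf P Q"
    by (simp add: add_pmf_def pair_pmf_def map_pmf_def bind_assoc_pmf bind_return_pmf)
  finally show ?thesis .
qed

text \<open>The triangle inequality gives the induction step; nonnegative integrals avoid
  integrability conditions.\<close>

lemma nn_integral_abs_sum_pmf_le:
  "(\<integral>\<^sup>+ x. ennreal \<bar>x\<bar> \<partial>sum_pmf m P) \<le> of_nat m * (\<integral>\<^sup>+ x. ennreal \<bar>x\<bar> \<partial>P)"
proof (induction m)
  case 0
  then show ?case by simp
next
  case (Suc m)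
  have "(\<integral>\<^sup>+ x. ennreal \<bar>x\<bar> \<partial>sum_pmf (Suc m) P) =
        (\<integral>\<^sup>+ x. \<integral>\<^sup>+ y. ennreal \<bar>x + y\<bar> \<partial>sum_pmf m P \<partial>P)"
    by (simp add: add_pmf_def)
  also have "\<dots> \<le> (\<integral>\<^sup>+ x. \<integral>\<^sup>+ y. ennreal \<bar>x\<bar> + ennreal \<bar>y\<bar> \<partial>sum_pmf m P \<partial>P)"
    by (intro nn_integral_mono) (simp add: ennreal_plus[symmetric] abs_triangle_ineq del: ennreal_plus)
  also have "\<dots> = (\<integral>\<^sup>+ x. ennreal \<bar>x\<bar> \<partial>P) + (\<integral>\<^sup>+ y. ennreal \<bar>y\<bar> \<partial>sum_pmf m P)"
    by (simp add: nn_integral_add)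
  also have "\<dots> \<le> (\<integral>\<^sup>+ x. ennreal \<bar>x\<bar> \<partial>P) + of_nat m * (\<integral>\<^sup>+ x. ennreal \<bar>x\<bar> \<partial>P)"
    using Suc by (intro add_mono) auto
  also have "\<dots> = of_nat (Suc m) * (\<integral>\<^sup>+ x. ennreal \<bar>x\<bar> \<partial>P)"
    by (simp add: algebra_simps)
  finally show ?case .
qed

lemma prob_abs_sum_pmf_ge_le:
  fixes P :: "real pmf"
  assumes "(\<integral>\<^sup>+ x. ennreal \<bar>x\<bar> \<partial>P) \<le> ennreal s" "0 \<le> s" "0 < t"
  shows "measure_pmf.prob (sum_pmf m P) {x. t \<le> \<bar>x\<bar>} \<le> real m * s / t"
proof -
  have "emeasure (sum_pmf m P) {x. t \<le> \<bar>x\<bar>} \<le>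
        ennreal (1 / t) * (\<integral>\<^sup>+ x. ennreal \<bar>x\<bar> \<partial>sum_pmf m P)"
  proof -
    have "{x. t \<le> \<bar>x\<bar>} = {x \<in> UNIV. 1 \<le> ennreal (1 / t) * ennreal \<bar>x\<bar>}"
      using assms(3) by (auto simp: ennreal_mult[symmetric] field_simps simp flip: ennreal_1)
    then show ?thesis
      using nn_integral_Markov_inequality[of "\<lambda>x. ennreal \<bar>x\<bar>" UNIV "sum_pmf m P" "ennreal (1 / t)"]
      by simp
  qed
  also have "\<dots> \<le> ennreal (1 / t) * (of_nat m * ennreal s)"
    using nn_integral_abs_sum_pmf_le[of m P] assms(1)
    by (meson mult_left_mono order_trans zero_le)
  also have "\<dots> = ennreal (m * s / t)"
    using assms by (simp add: ennreal_mult[symmetric] ennreal_of_nat_eq_real_of_nat)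
  finally show ?thesis using assms by (simp add: measure_pmf.emeasure_eq_measure)
qed

text \<open>The summands are realized as the coordinates of the product law \<open>W\<close>, where
  Hoeffding's inequality for i.i.d. bounded variables applies.\<close>

lemma sum_pmf_Hoeffding:
  assumes P: "set_pmf P \<subseteq> {a..b}" and ab: "a < b" and m: "0 < m" and t: "0 \<le> t"
  shows "measure_pmf.prob (sum_pmf m P) {s. t \<le> \<bar>s - m * measure_pmf.expectation P (\<lambda>x. x)\<bar>}
         \<le> 2 * exp (-2 * t\<^sup>2 / (m * (b - a)\<^sup>2))"
proof -
  define W where "W = Pi_pmf {..<m} 0 (\<lambda>_. P)"
  have comp: "map_pmf (\<lambda>f. f v) W = P" if "v < m" for v
    using that by (simp add: W_def Pi_pmf_component)
  have dist: "distr (measure_pmf W) borel (\<lambda>f. f v) = distr (measure_pmf P) borel (\<lambda>x. x)" if "v < m" for v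
    by (subst comp[OF that, symmetric], subst map_pmf_rep_eq, subst distr_distr) (auto simp: o_def)
  have e0: "measure_pmf.expectation W (\<lambda>f. f 0) = measure_pmf.expectation P (\<lambda>x. x)"
    by (subst comp[OF m, symmetric]) simp
  interpret Hoeffding_ineq_iid "measure_pmf W" "{..<m}" "\<lambda>v f. f v" "\<lambda>f. f 0" a b
    "measure_pmf.expectation P (\<lambda>x. x)"
  proof unfold_locales
    show "prob_space.indep_vars (measure_pmf W) (\<lambda>_. borel) (\<lambda>v f. f v) {..<m}"
      unfolding W_def
      by (intro prob_space.indep_vars_compose2[OF measure_pmf.prob_space_axioms indep_vars_Pi_pmf]) auto
    show "AE f in W. f 0 \<in> {a..b}"
      using P m by (auto simp: AE_measure_pmf_iff W_def set_Pi_pmf PiE_dflt_def)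
  qed (use m dist e0 in auto)
  have "measure_pmf.prob W {f. t \<le> \<bar>(\<Sum>v<m. f v) - m * measure_pmf.expectation P (\<lambda>x. x)\<bar>}
     \<le> 2 * exp (-2 * t\<^sup>2 / (m * (b - a)\<^sup>2))"
    using Hoeffding_ineq_abs_ge[OF t ab] m by auto
  then show ?thesis
    by (subst sum_pmf_conv_Pi_pmf[of _ _ 0]) (simp add: W_def vimage_def)
qed

section \<open>Sparse noise\<close>

lemma measure_bind_bernoulli_pmf:
  assumes "\<rho> \<in> {0..1}"
  shows "measure_pmf.prob (bind_pmf (bernoulli_pmf \<rho>) f) A =
         \<rho> * measure_pmf.prob (f True) A + (1 - \<rho>) * measure_pmf.prob (f False) A"
proof -
  have "measure_pmf.prob (bind_pmf (bernoulli_pmf \<rho>) f) A = measure_pmf.expectation (bernoulli_pmf \<rho>)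
      (\<lambda>b. measure_pmf.prob (f b) A)"
    unfolding measure_pmf_bind
    by (rule measure_pmf.measure_bind[where N = "count_space UNIV"])
       (auto simp: measure_pmf_in_subprob_algebra)
  then show ?thesis using assms by simp
qed

definition sparse_pmf :: "real \<Rightarrow> real pmf \<Rightarrow> real pmf" where
  "sparse_pmf \<rho> Q = bind_pmf (bernoulli_pmf \<rho>) (\<lambda>b. if b then Q else return_pmf 0)"

lemma prob_sparse_pmf:
  assumes "\<rho> \<in> {0..1}"
  shows "measure_pmf.prob (sparse_pmf \<rho> Q) A =
         \<rho> * measure_pmf.prob Q A + (1 - \<rho>) * indicator A 0"
  unfolding sparse_pmf_def measure_bind_bernoulli_pmf[OF assms] by (simp add: measure_return_pmf)

lemma nn_integral_sparse_pmf:
  assumes "\<rho> \<in> {0..1}" "f 0 = 0"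
  shows "(\<integral>\<^sup>+ x. f x \<partial>sparse_pmf \<rho> Q) = ennreal \<rho> * (\<integral>\<^sup>+ x. f x \<partial>Q)"
  using assms by (simp add: sparse_pmf_def mult.commute)

lemma prob_sum_sparse_pmf_zero_ge:
  assumes "\<rho> \<in> {0..1}"
  shows "(1 - \<rho>) ^ m \<le> measure_pmf.prob (sum_pmf m (sparse_pmf \<rho> Q)) {0}"
proof (induction m)
  case 0
  then show ?case by (simp add: measure_return_pmf)
next
  case (Suc m)
  have "1 - \<rho> \<le> measure_pmf.prob (sparse_pmf \<rho> Q) {0}"
    using assms by (simp add: prob_sparse_pmf)
  then have "(1 - \<rho>) * (1 - \<rho>) ^ m \<le>
     measure_pmf.prob (sparse_pmf \<rho> Q) {0} * measure_pmf.prob (sum_pmf m (sparse_pmf \<rho> Q)) {0}"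
    using Suc assms by (intro mult_mono) auto
  also have "\<dots> \<le> measure_pmf.prob (sum_pmf (Suc m) (sparse_pmf \<rho> Q)) {0}"
    unfolding sum_pmf.simps by (rule prob_add_pmf_ge) auto
  finally show ?case by simp
qed

text \<open>Keeps only the event that exactly one summand is nonzero.\<close>

lemma prob_sum_sparse_pmf_ge:
  assumes \<rho>: "\<rho> \<in> {0..1}"
  shows "m * \<rho> * (1 - \<rho>) ^ (m - 1) * measure_pmf.prob Q A \<le>
         measure_pmf.prob (sum_pmf m (sparse_pmf \<rho> Q)) A"
proof (induction m)
  case 0
  then show ?case by simp
next
  case (Suc m)
  let ?S = "sum_pmf m (sparse_pmf \<rho> Q)"
  \<comment> \<open>Condition on whether the first summand is noisy. If it is, all the others are
    required to vanish (bound \<open>1\<close>); if not, the induction hypothesis applies (bound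
    \<open>2\<close>).\<close>
  have eq: "sum_pmf (Suc m) (sparse_pmf \<rho> Q) =
      bind_pmf (bernoulli_pmf \<rho>) (\<lambda>b. if b then add_pmf Q ?S else ?S)"
    unfolding sum_pmf.simps sparse_pmf_def[of \<rho> Q] add_pmf_def bind_assoc_pmf
    by (intro bind_pmf_cong) (auto simp: bind_return_pmf sparse_pmf_def map_pmf_idI)
  have "measure_pmf.prob Q A * (1 - \<rho>) ^ m \<le> measure_pmf.prob Q A * measure_pmf.prob ?S {0}"
    using prob_sum_sparse_pmf_zero_ge[OF \<rho>] by (intro mult_left_mono) auto
  also have "\<dots> \<le> measure_pmf.prob (add_pmf Q ?S) A"
    by (rule prob_add_pmf_ge) auto
  finally have 1: "\<rho> * (measure_pmf.prob Q A * (1 - \<rho>) ^ m) \<le> \<rho> * measure_pmf.prob (add_pmf Q ?S) A"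
    using \<rho> by (intro mult_left_mono) auto
  have 2: "(1 - \<rho>) * (m * \<rho> * (1 - \<rho>) ^ (m - 1) * measure_pmf.prob Q A) \<le>
    (1 - \<rho>) * measure_pmf.prob ?S A"
    using \<rho> by (intro mult_left_mono Suc) auto
  have "Suc m * \<rho> * (1 - \<rho>) ^ (Suc m - 1) * measure_pmf.prob Q A =
    \<rho> * (measure_pmf.prob Q A * (1 - \<rho>) ^ m)
    + (1 - \<rho>) * (m * \<rho> * (1 - \<rho>) ^ (m - 1) * measure_pmf.prob Q A)"
    by (cases m) (auto simp: algebra_simps)
  also have "\<dots> \<le> measure_pmf.prob (sum_pmf (Suc m) (sparse_pmf \<rho> Q)) A"
    unfolding eq measure_bind_bernoulli_pmf[OF \<rho>] using 1 2 by simp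
  finally show ?case .
qed

text \<open>A discrete stand-in for the uniform law on [-1,1], which keeps all noise within finitely
  supported \<open>pmf\<close>s.\<close>

definition grid_pmf :: "nat \<Rightarrow> real pmf" where
  "grid_pmf N = map_pmf (\<lambda>j. of_int j / N) (pmf_of_set {- int N..int N})"

lemma set_pmf_grid_pmf: "set_pmf (grid_pmf N) \<subseteq> {-1..1}"
  by (auto simp: grid_pmf_def field_simps divide_le_eq le_divide_eq)

lemma expectation_grid_pmf: "measure_pmf.expectation (grid_pmf N) (\<lambda>x. x) = 0"
proof -
  have "(\<Sum>j\<in>{- int N..int N}. real_of_int j) = (\<Sum>j\<in>{- int N..int N}. - real_of_int j)"
    by (rule sum.reindex_bij_witness[of _ uminus uminus]) auto
  then have "(\<Sum>j\<in>{- int N..int N}. real_of_int j) = 0" by (simp add: sum_negf)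
  then show ?thesis
    by (simp add: grid_pmf_def integral_pmf_of_set sum_divide_distrib[symmetric])
qed

text \<open>A one-sided window of length \<open>w\<close> holds at least \<open>N * w - 1\<close>,
  hence at least \<open>N * w / 2\<close>, of the \<open>2 * N + 1 \<le> 3 * N\<close> grid
  points.\<close>

lemma prob_grid_pmf_near:
  assumes w: "0 < w" "w \<le> 1" "2 \<le> N * w" and t: "\<bar>t\<bar> \<le> 1"
  shows "w / 6 \<le> measure_pmf.prob (grid_pmf N) {x. \<bar>x - t\<bar> < w}"
proof -
  have N: "0 < N" using w(3) by (cases N) auto
  \<comment> \<open>The window extends from \<open>t\<close> towards zero, so it stays inside [-1,1]
    even when \<open>t\<close> is an endpoint.\<close>
  define J where "J = (if 0 \<le> t then {\<lfloor>N * (t - w)\<rfloor> + 1..\<lfloor>N * t\<rfloor>} else {\<lceil>N * t\<rceil>..\<lceil>N * (t + w)\<rceil> - 1})"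
  have Nt: "N * t \<le> N" "- real N \<le> N * t" "N * w \<le> N"
    using t w N by (auto simp: abs_le_iff mult_left_le le_minus_iff
        intro: mult_left_mono[of "-1" t "real N", simplified])
  have sub: "J \<subseteq> {- int N..int N}"
  proof -
    have "- int N \<le> \<lfloor>N * (t - w)\<rfloor> + 1" "\<lfloor>N * t\<rfloor> \<le> int N" if "0 \<le> t"
    proof -
      have "0 \<le> N * t" using that by simp
      then have "- real N \<le> N * (t - w)" using Nt by (simp add: algebra_simps)
      then show "- int N \<le> \<lfloor>N * (t - w)\<rfloor> + 1" "\<lfloor>N * t\<rfloor> \<le> int N" using Nt by linarith+
    qed
    moreover have "- int N \<le> \<lceil>N * t\<rceil>" "\<lceil>N * (t + w)\<rceil> - 1 \<le> int N" if "\<not> 0 \<le> t"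
    proof -
      have "N * t \<le> 0" using that by (simp add: mult_nonneg_nonpos)
      then have "N * (t + w) \<le> N" using Nt by (simp add: algebra_simps)
      then show "- int N \<le> \<lceil>N * t\<rceil>" "\<lceil>N * (t + w)\<rceil> - 1 \<le> int N" using Nt by linarith+
    qed
    ultimately show ?thesis unfolding J_def by auto
  qed
  have near: "\<bar>of_int j / N - t\<bar> < w" if "j \<in> J" for j
  proof -
    have "N * (t - w) < of_int j" "of_int j < N * (t + w)"
    proof -
      have "N * t < N * (t + w)" "N * (t - w) < N * t" using N w by auto
      moreover have "N * (t - w) < of_int j \<and> of_int j \<le> N * t
         \<or> N * t \<le> of_int j \<and> of_int j < N * (t + w)"
        using that unfolding J_def by (auto split: if_splits; linarith)
      ultimately show "N * (t - w) < of_int j" "of_int j < N * (t + w)" by auto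
    qed
    then have "t - w < of_int j / N" "of_int j / N < t + w"
      using N by (auto simp: field_simps)
    then show ?thesis by linarith
  qed
  have "N * w - 1 \<le> card J"
  proof (cases "0 \<le> t")
    case True
    have "N * w - 1 < of_int (\<lfloor>N * t\<rfloor> - \<lfloor>N * (t - w)\<rfloor>)"
      by (simp add: right_diff_distrib) linarith
    then show ?thesis using True by (simp add: J_def)
  next
    case False
    have "N * w - 1 < of_int (\<lceil>N * (t + w)\<rceil> - \<lceil>N * t\<rceil>)"
      by (simp add: distrib_left) linarith
    then show ?thesis using False by (simp add: J_def)
  qed
  then have "N * w / 2 \<le> card J" using w(3) by linarith
  also have "card J \<le> card ({- int N..int N} \<inter> (\<lambda>j. of_int j / N) -` {x. \<bar>x - t\<bar> < w})"
    using sub near by (intro card_mono) auto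
  finally have c: "N * w / 2 \<le> \<dots>" by simp
  have "w / 6 = (N * w / 2) / (3 * N)" using N by simp
  also have "\<dots> \<le> (N * w / 2) / (2 * N + 1)"
    using N w by (intro divide_left_mono) auto
  also have "\<dots> \<le> card ({- int N..int N} \<inter> (\<lambda>j. of_int j / N) -` {x. \<bar>x - t\<bar> < w}) / (2 * N + 1)"
    using c by (intro divide_right_mono) auto
  also have "\<dots> = measure_pmf.prob (grid_pmf N) {x. \<bar>x - t\<bar> < w}"
    by (simp add: grid_pmf_def measure_pmf_of_set add.commute)
  finally show ?thesis .
qed

section \<open>The noisy observation of a voter\<close>

text \<open>The rate \<open>\<epsilon> / 16\<close> bounds the mean absolute total noise by
  \<open>m * \<epsilon> / 16\<close>, and by 1/2 the expected number of noisy voters when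
  \<open>m * \<epsilon> \<le> 8\<close>. The grid spacing is at most \<open>\<epsilon> / 16\<close>,
  fine enough even for a single voter.\<close>

definition noise_pmf :: "real \<Rightarrow> real pmf" where
  "noise_pmf \<epsilon> = sparse_pmf (\<epsilon> / 16) (grid_pmf (nat \<lceil>16 / \<epsilon>\<rceil>))"

definition signal_pmf :: "real \<Rightarrow> real \<Rightarrow> real pmf" where
  "signal_pmf \<epsilon> q = add_pmf (map_pmf of_bool (bernoulli_pmf q)) (noise_pmf \<epsilon>)"

context
  fixes \<epsilon> q :: real
  assumes \<epsilon>: "0 < \<epsilon>" "\<epsilon> \<le> 1" and q: "q \<in> {0..1}"
begin

lemma set_pmf_noise_pmf: "set_pmf (noise_pmf \<epsilon>) \<subseteq> {-1..1}"
  using set_pmf_grid_pmf[of "nat \<lceil>16 / \<epsilon>\<rceil>"]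
  by (auto simp: noise_pmf_def sparse_pmf_def split: if_splits)

lemma set_pmf_signal_pmf: "set_pmf (signal_pmf \<epsilon> q) \<subseteq> {-1..2}"
  using set_pmf_noise_pmf by (fastforce simp: signal_pmf_def add_pmf_def)

lemma nn_integral_abs_noise_pmf_le: "(\<integral>\<^sup>+ x. ennreal \<bar>x\<bar> \<partial>noise_pmf \<epsilon>) \<le> ennreal (\<epsilon> / 16)"
proof -
  let ?Q = "grid_pmf (nat \<lceil>16 / \<epsilon>\<rceil>)"
  have "(\<integral>\<^sup>+ x. ennreal \<bar>x\<bar> \<partial>?Q) \<le> (\<integral>\<^sup>+ x. 1 \<partial>?Q)"
    using set_pmf_grid_pmf[of "nat \<lceil>16 / \<epsilon>\<rceil>"]
    by (intro nn_integral_mono_AE) (auto simp: AE_measure_pmf_iff abs_le_iff)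
  also have "\<dots> = 1" by (simp add: measure_pmf.emeasure_space_1)
  finally have "ennreal (\<epsilon> / 16) * (\<integral>\<^sup>+ x. ennreal \<bar>x\<bar> \<partial>?Q) \<le> ennreal (\<epsilon> / 16) * 1"
    by (intro mult_left_mono) auto
  then show ?thesis using \<epsilon> by (simp add: noise_pmf_def nn_integral_sparse_pmf)
qed

lemma expectation_noise_pmf: "measure_pmf.expectation (noise_pmf \<epsilon>) (\<lambda>x. x) = 0"
proof -
  let ?Q = "grid_pmf (nat \<lceil>16 / \<epsilon>\<rceil>)"
  have fin: "finite (set_pmf (if b then ?Q else return_pmf 0))" for b :: bool
    by (auto simp: grid_pmf_def)
  have "measure_pmf.expectation (noise_pmf \<epsilon>) (\<lambda>x. x) =
     (\<Sum>b\<in>UNIV. pmf (bernoulli_pmf (\<epsilon> / 16)) b *\<^sub>R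
        measure_pmf.expectation (if b then ?Q else return_pmf 0) (\<lambda>x. x))"
    unfolding noise_pmf_def sparse_pmf_def
    by (rule pmf_expectation_bind) (use fin in auto)
  then show ?thesis by (simp add: UNIV_bool expectation_grid_pmf)
qed

lemma expectation_signal_pmf: "measure_pmf.expectation (signal_pmf \<epsilon> q) (\<lambda>x. x) = q"
proof -
  have fin: "finite (set_pmf (noise_pmf \<epsilon>))"
    by (auto simp: noise_pmf_def sparse_pmf_def grid_pmf_def)
  then have int: "integrable (noise_pmf \<epsilon>) f" for f :: "real \<Rightarrow> real"
    by (rule integrable_measure_pmf_finite)
  have "measure_pmf.expectation (signal_pmf \<epsilon> q) (\<lambda>x. x) =
     (\<Sum>b\<in>UNIV. pmf (bernoulli_pmf q) b *\<^sub>R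
        measure_pmf.expectation (map_pmf (\<lambda>y. of_bool b + y) (noise_pmf \<epsilon>)) (\<lambda>x. x))"
    unfolding signal_pmf_def add_pmf_def bind_map_pmf
    by (rule pmf_expectation_bind) (use fin in auto)
  also have "\<dots> = q"
    using q int[of "\<lambda>x. x"] by (simp add: UNIV_bool expectation_noise_pmf Bochner_Integration.integral_add)
  finally show ?thesis .
qed

lemma sum_signal_pmf:
  "sum_pmf m (signal_pmf \<epsilon> q) =
   add_pmf (map_pmf real (binomial_pmf m q)) (sum_pmf m (noise_pmf \<epsilon>))"
  by (simp only: signal_pmf_def sum_pmf_add_pmf sum_pmf_bernoulli[OF q])

section \<open>Concentration of the total signal in three ranges of \<open>m\<close>\<close>

lemma prob_sum_signal_many_voters:
  assumes m: "36 \<le> m * \<epsilon>\<^sup>2"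
  shows "1 - exp (- (m * \<epsilon>\<^sup>2 / 36)) \<le>
         measure_pmf.prob (sum_pmf m (signal_pmf \<epsilon> q)) {s. \<bar>s - m * q\<bar> < m * \<epsilon> / 2}"
proof -
  let ?P = "sum_pmf m (signal_pmf \<epsilon> q)"
  \<comment> \<open>Half of the Hoeffding exponent \<open>m * \<epsilon>\<^sup>2 / 18\<close> for
    range 3; the other half absorbs the prefactor 2, because \<open>exp y \<ge> 2\<close>.\<close>
  define y where "y = m * \<epsilon>\<^sup>2 / 36"
  have y: "1 \<le> y" using m by (simp add: y_def)
  have m0: "0 < m" using m by (cases m) auto
  have "measure_pmf.prob ?P {s. m * \<epsilon> / 2 \<le> \<bar>s - m * q\<bar>}
        \<le> 2 * exp (-2 * (m * \<epsilon> / 2)\<^sup>2 / (m * (2 - (-1))\<^sup>2))"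
    using sum_pmf_Hoeffding[OF set_pmf_signal_pmf _ m0, of "m * \<epsilon> / 2"] \<epsilon>
    by (simp add: expectation_signal_pmf)
  also have "-2 * (m * \<epsilon> / 2)\<^sup>2 / (m * (2 - (-1))\<^sup>2) = - y + - y"
    using m0 by (simp add: y_def field_simps power2_eq_square)
  also have "2 * exp (- y + - y) \<le> exp (- y)"
  proof -
    have "2 \<le> exp y" using exp_ge_add_one_self[of y] y by linarith
    then have "2 * exp (- y) \<le> 1" by (simp add: exp_minus field_simps)
    then have "(2 * exp (- y)) * exp (- y) \<le> 1 * exp (- y)" by (intro mult_right_mono) auto
    then show ?thesis unfolding exp_add by simp
  qed
  finally have "measure_pmf.prob ?P {s. m * \<epsilon> / 2 \<le> \<bar>s - m * q\<bar>} \<le> exp (- y)" .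
  moreover have "measure_pmf.prob ?P {s. \<bar>s - m * q\<bar> < m * \<epsilon> / 2} =
      1 - measure_pmf.prob ?P {s. m * \<epsilon> / 2 \<le> \<bar>s - m * q\<bar>}"
  proof -
    have "{s. \<bar>s - m * q\<bar> < m * \<epsilon> / 2} = UNIV - {s. m * \<epsilon> / 2 \<le> \<bar>s - m * q\<bar>}" by auto
    then show ?thesis
      using measure_pmf.prob_compl[of "{s. m * \<epsilon> / 2 \<le> \<bar>s - m * q\<bar>}" ?P] by simp
  qed
  ultimately show ?thesis by (simp add: y_def)
qed

lemma prob_sum_signal_medium_voters:
  assumes m: "8 \<le> m * \<epsilon>" "m * \<epsilon>\<^sup>2 \<le> 36"
  shows "m * \<epsilon>\<^sup>2 / 1200 \<le>
         measure_pmf.prob (sum_pmf m (signal_pmf \<epsilon> q)) {s. \<bar>s - m * q\<bar> < m * \<epsilon> / 2}"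
proof -
  define x where "x = sqrt m"
  \<comment> \<open>The largest integer strictly below \<open>m * \<epsilon> / 4\<close>. Since that
    number is at least 2, \<open>L\<close> is at least half of it.\<close>
  define L where "L = nat (\<lceil>m * \<epsilon> / 4\<rceil> - 1)"
  let ?M = "binomial_mode m q"
  have m0: "0 < m" using m by (cases m) auto
  have x: "1 \<le> x" and xm: "real m = x * x" using m0 by (auto simp: x_def)
  have L: "real L < m * \<epsilon> / 4" "m * \<epsilon> / 8 \<le> real L" "0 < L"
    using m(1) unfolding L_def by linarith+
  have "(x * \<epsilon>)\<^sup>2 \<le> 6\<^sup>2" using m(2) by (simp add: xm power2_eq_square algebra_simps)
  then have x6: "x * \<epsilon> \<le> 6" by (rule power2_le_imp_le) simp
  have "m * \<epsilon> \<le> 6 * x" using mult_left_mono[OF x6, of x] x by (simp add: xm algebra_simps)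
  then have den: "real L + x + 2 \<le> 4.5 * x" using L(1) x by linarith
  \<comment> \<open>The window has probability of order \<open>x * \<epsilon>\<close>; as
    \<open>x * \<epsilon> \<le> 6\<close>, this dominates a multiple of its square
    \<open>m * \<epsilon>\<^sup>2\<close>.\<close>
  have "x * \<epsilon> * (x * \<epsilon>) \<le> 6 * (x * \<epsilon>)"
    using x6 \<epsilon> x by (intro mult_right_mono) auto
  then have "m * \<epsilon>\<^sup>2 / 900 \<le> (x * \<epsilon>) / 150"
    by (simp add: xm power2_eq_square algebra_simps)
  also have "\<dots> \<le> (m * \<epsilon> / 8) / (4 * (4.5 * x))"
    using x \<epsilon> by (simp add: xm field_simps)
  also have "\<dots> \<le> real L / (4 * (real L + x + 2))"
    using L den x m0 \<epsilon> by (intro frac_le) auto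
  also have "\<dots> \<le> measure_pmf.prob (binomial_pmf m q) {k. \<bar>real k - ?M\<bar> < L}"
    using prob_binomial_near_mode[OF q m0 L(3)] by (simp add: x_def)
  also have "\<dots> \<le> measure_pmf.prob (binomial_pmf m q) {k. \<bar>real k - m * q\<bar> < m * \<epsilon> / 4}"
  proof (rule measure_pmf.finite_measure_mono)
    have "\<bar>real k - m * q\<bar> < m * \<epsilon> / 4" if "\<bar>real k - ?M\<bar> < L" for k
    proof -
      \<comment> \<open>Integrality improves \<open>< L\<close> to \<open>\<le> L - 1\<close>; the
        unit gained pays for the distance from mode to mean.\<close>
      have "\<bar>int k - ?M\<bar> < int L" using that by linarith
      then have "\<bar>int k - ?M\<bar> \<le> int L - 1" by linarith
      then have "\<bar>real k - ?M\<bar> \<le> real L - 1" by linarith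
      then show ?thesis using binomial_mode_near_mean[OF q, of m] L(1) by linarith
    qed
    then show "{k. \<bar>real k - ?M\<bar> < L} \<subseteq> {k. \<bar>real k - m * q\<bar> < m * \<epsilon> / 4}" by blast
  qed simp
  finally have bin: "m * \<epsilon>\<^sup>2 / 900 \<le>
     measure_pmf.prob (map_pmf real (binomial_pmf m q)) {k. \<bar>k - m * q\<bar> < m * \<epsilon> / 4}"
    by (simp add: vimage_def)
  have "measure_pmf.prob (sum_pmf m (noise_pmf \<epsilon>)) {z. m * \<epsilon> / 4 \<le> \<bar>z\<bar>} \<le> m * (\<epsilon> / 16) / (m * \<epsilon> / 4)"
    using m0 \<epsilon> by (intro prob_abs_sum_pmf_ge_le nn_integral_abs_noise_pmf_le) auto
  also have "\<dots> = 1 / 4" using m0 \<epsilon> by simp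
  finally have "measure_pmf.prob (sum_pmf m (noise_pmf \<epsilon>)) {z. m * \<epsilon> / 4 \<le> \<bar>z\<bar>} \<le> 1 / 4" .
  moreover have "{z. \<bar>z\<bar> < m * \<epsilon> / 4} = UNIV - {z. m * \<epsilon> / 4 \<le> \<bar>z\<bar>}" by auto
  ultimately have noise: "3 / 4 \<le> measure_pmf.prob (sum_pmf m (noise_pmf \<epsilon>)) {z. \<bar>z\<bar> < m * \<epsilon> / 4}"
    using measure_pmf.prob_compl[of "{z. m * \<epsilon> / 4 \<le> \<bar>z\<bar>}" "sum_pmf m (noise_pmf \<epsilon>)"] by simp
  have "m * \<epsilon>\<^sup>2 / 1200 = m * \<epsilon>\<^sup>2 / 900 * (3 / 4)" by simp
  also have "\<dots> \<le> measure_pmf.prob (map_pmf real (binomial_pmf m q)) {k. \<bar>k - m * q\<bar> < m * \<epsilon> / 4} *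
     measure_pmf.prob (sum_pmf m (noise_pmf \<epsilon>)) {z. \<bar>z\<bar> < m * \<epsilon> / 4}"
    using bin noise by (intro mult_mono) auto
  also have "\<dots> \<le> measure_pmf.prob (sum_pmf m (signal_pmf \<epsilon> q)) {s. \<bar>s - m * q\<bar> < m * \<epsilon> / 2}"
    unfolding sum_signal_pmf by (rule prob_add_pmf_ge, unfold mem_Collect_eq) linarith
  finally show ?thesis .
qed

text \<open>Three factors are multiplied: \<open>1 / (16 * m)\<close> for hitting the mode, at least
  \<open>m * \<epsilon> / 32\<close> for exactly one noisy voter, and
  \<open>m * \<epsilon> / 48\<close> for that noise landing near \<open>t\<close>. The denominator
  is 24576, rounded up to 25000.\<close>

lemma prob_sum_signal_few_voters:
  assumes m: "0 < m" "m * \<epsilon> \<le> 8"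
  shows "m * \<epsilon>\<^sup>2 / 25000 \<le>
         measure_pmf.prob (sum_pmf m (signal_pmf \<epsilon> q)) {s. \<bar>s - m * q\<bar> < m * \<epsilon> / 2}"
proof -
  let ?M = "binomial_mode m q" and ?N = "nat \<lceil>16 / \<epsilon>\<rceil>"
  \<comment> \<open>The correction the noise has to supply; \<open>\<bar>t\<bar> \<le> 1\<close>
    puts it in the range of the grid.\<close>
  define t where "t = m * q - ?M"
  have "1 * 1 \<le> real m * real m" using m by (intro mult_mono) auto
  then have "sqrt m \<le> real m" "1 \<le> sqrt m" using m by (auto intro!: real_le_lsqrt simp: power2_eq_square)
  then have "1 / (16 * m) \<le> real 1 / (4 * (real 1 + sqrt m + 2))"
    by (intro frac_le) (auto intro: add_pos_nonneg)
  also have "\<dots> \<le> measure_pmf.prob (binomial_pmf m q) {k. \<bar>real k - ?M\<bar> < real 1}"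
    by (rule prob_binomial_near_mode[OF q m(1)]) simp
  also have "{k. \<bar>real k - ?M\<bar> < real 1} = real -` {real ?M}" by auto
  finally have bin: "1 / (16 * m) \<le> measure_pmf.prob (map_pmf real (binomial_pmf m q)) {real ?M}"
    by simp
  have "2 \<le> 2 * real m" using m by simp
  also have "\<dots> = 16 / \<epsilon> * (m * \<epsilon> / 8)" using \<epsilon> by simp
  also have "\<dots> \<le> ?N * (m * \<epsilon> / 8)" using \<epsilon> by (intro mult_right_mono) (auto intro: real_nat_ceiling_ge)
  finally have "2 \<le> ?N * (m * \<epsilon> / 8)" .
  moreover have "\<bar>t\<bar> \<le> 1" using binomial_mode_near_mean[OF q, of m] by (simp add: t_def)
  \<comment> \<open>The half-width \<open>m * \<epsilon> / 8\<close> replaces the available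
    \<open>m * \<epsilon> / 2\<close> because \<open>prob_grid_pmf_near\<close> asks for a width of
    at most 1.\<close>
  ultimately have "(m * \<epsilon> / 8) / 6 \<le> measure_pmf.prob (grid_pmf ?N) {z. \<bar>z - t\<bar> < m * \<epsilon> / 8}"
    using m \<epsilon> by (intro prob_grid_pmf_near) auto
  also have "\<dots> \<le> measure_pmf.prob (grid_pmf ?N) {z. \<bar>z - t\<bar> < m * \<epsilon> / 2}"
  proof (rule measure_pmf.finite_measure_mono)
    have "m * \<epsilon> / 8 \<le> m * \<epsilon> / 2" using \<epsilon> by simp
    then show "{z. \<bar>z - t\<bar> < m * \<epsilon> / 8} \<subseteq> {z. \<bar>z - t\<bar> < m * \<epsilon> / 2}"
      by (meson Collect_mono less_le_trans)
  qed simp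
  finally have grid: "m * \<epsilon> / 48 \<le> \<dots>" by simp
  have "real (m - 1) * \<epsilon> = m * \<epsilon> - \<epsilon>" using m by (simp add: of_nat_diff algebra_simps)
  \<comment> \<open>By Bernoulli's inequality, the other \<open>m - 1\<close> voters are all
    noiseless with probability at least 1/2.\<close>
  then have "1 / 2 \<le> 1 + real (m - 1) * (- (\<epsilon> / 16))" using m \<epsilon> by simp
  also have "\<dots> \<le> (1 + - (\<epsilon> / 16)) ^ (m - 1)"
    using \<epsilon> by (intro Bernoulli_inequality) auto
  finally have one: "1 / 2 \<le> (1 - \<epsilon> / 16) ^ (m - 1)" by simp
  have "m * (\<epsilon> / 16) * (1 / 2) * (m * \<epsilon> / 48) \<le>
     m * (\<epsilon> / 16) * (1 - \<epsilon> / 16) ^ (m - 1) * measure_pmf.prob (grid_pmf ?N) {z. \<bar>z - t\<bar> < m * \<epsilon> / 2}"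
    using one grid \<epsilon> by (intro mult_mono order_refl) auto
  also have "\<dots> \<le> measure_pmf.prob (sum_pmf m (noise_pmf \<epsilon>)) {z. \<bar>z - t\<bar> < m * \<epsilon> / 2}"
    unfolding noise_pmf_def using \<epsilon> by (intro prob_sum_sparse_pmf_ge) auto
  finally have noise: "m * (\<epsilon> / 16) * (1 / 2) * (m * \<epsilon> / 48) \<le> \<dots>" .
  have "m * \<epsilon>\<^sup>2 / 25000 \<le> m * \<epsilon>\<^sup>2 / 24576" by (intro divide_left_mono) auto
  also have "\<dots> = 1 / (16 * m) * (m * (\<epsilon> / 16) * (1 / 2) * (m * \<epsilon> / 48))"
    using m by (simp add: power2_eq_square)
  also have "\<dots> \<le> measure_pmf.prob (map_pmf real (binomial_pmf m q)) {real ?M} *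
     measure_pmf.prob (sum_pmf m (noise_pmf \<epsilon>)) {z. \<bar>z - t\<bar> < m * \<epsilon> / 2}"
    using bin noise \<epsilon> by (intro mult_mono) auto
  also have "\<dots> \<le> measure_pmf.prob (sum_pmf m (signal_pmf \<epsilon> q)) {s. \<bar>s - m * q\<bar> < m * \<epsilon> / 2}"
    unfolding sum_signal_pmf by (rule prob_add_pmf_ge) (auto simp: t_def algebra_simps)
  finally show ?thesis .
qed

text \<open>One bound covers all ranges: a linear lower bound suffices in the two smaller ones since
  \<open>1 - exp (- z) \<le> z\<close>, and 25000 is the largest of the three denominators.\<close>

lemma prob_sum_signal:
  assumes m: "0 < m"
  shows "1 - exp (- (m * \<epsilon>\<^sup>2 / 25000)) \<le>
         measure_pmf.prob (sum_pmf m (signal_pmf \<epsilon> q)) {s. \<bar>s - m * q\<bar> < m * \<epsilon> / 2}"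
proof -
  have *: "1 - exp (- (m * \<epsilon>\<^sup>2 / 25000)) \<le> m * \<epsilon>\<^sup>2 / 25000"
    using exp_ge_add_one_self[of "- (m * \<epsilon>\<^sup>2 / 25000)"] by linarith
  have pos: "0 \<le> m * \<epsilon>\<^sup>2" by simp
  consider "36 \<le> m * \<epsilon>\<^sup>2" | "8 \<le> m * \<epsilon>" "m * \<epsilon>\<^sup>2 \<le> 36" | "m * \<epsilon> \<le> 8" by linarith
  then show ?thesis
  proof cases
    case 1
    have "exp (- (m * \<epsilon>\<^sup>2 / 36)) \<le> exp (- (m * \<epsilon>\<^sup>2 / 25000))" using pos by simp
    with prob_sum_signal_many_voters[OF 1] show ?thesis by linarith
  next
    case 2
    from prob_sum_signal_medium_voters[OF 2] * pos show ?thesis by linarith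
  next
    case 3
    from prob_sum_signal_few_voters[OF m 3] * show ?thesis by linarith
  qed
qed

end

section \<open>The voting scheme\<close>

text \<open>
  The scores are tangent lines of the parabola \<open>y\<^sup>2\<close>, so the urn whose fraction is nearest to
  the mean observation gets the largest total. Subtracting the average makes the scores sum to 1
  without affecting comparisons. The clamping of \<open>x\<close> is never active on observations; it makes
  every value of the function a valid ballot.
\<close>

definition ballot :: "nat \<Rightarrow> (nat \<Rightarrow> real) \<Rightarrow> real \<Rightarrow> nat \<Rightarrow> real" where
  "ballot n p x =
     (let y = max (-1) (min 2 x); g = (\<lambda>i. 2 * p i * y - (p i)\<^sup>2)
      in (\<lambda>i\<in>{1..n}. 1 / n + (g i - (\<Sum>j=1..n. g j) / n) / (10 * n)))"

text \<open>Since \<open>\<bar>y\<bar> \<le> 2\<close>, every \<open>g i\<close> lies in [-5,5], so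
  it falls below the average by at most 10. Dividing by \<open>10 * n\<close> lowers the base score
  \<open>1 / n\<close> to no less than 0.\<close>

lemma ballot_in_ballots:
  assumes n: "0 < n" and p: "\<And>i. i \<in> {1..n} \<Longrightarrow> p i \<in> {0..1}"
  shows "ballot n p x \<in> ballots n"
proof -
  define y where "y = max (-1) (min 2 x)"
  define g where "g i = 2 * p i * y - (p i)\<^sup>2" for i
  define a where "a = (\<Sum>j=1..n. g j) / n"
  have b: "ballot n p x = (\<lambda>i\<in>{1..n}. 1 / n + (g i - a) / (10 * n))"
    by (simp add: ballot_def Let_def g_def y_def a_def)
  have y: "-1 \<le> y" "y \<le> 2" by (auto simp: y_def)
  have g: "-5 \<le> g i" "g i \<le> 5" if "i \<in> {1..n}" for i
  proof -
    have pi: "0 \<le> p i" "p i \<le> 1" using p[OF that] by auto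
    have "\<bar>p i * y\<bar> \<le> 1 * 2" unfolding abs_mult using pi y by (intro mult_mono) auto
    moreover have "0 \<le> (p i)\<^sup>2" "(p i)\<^sup>2 \<le> 1" using pi by (auto simp: power_le_one)
    ultimately show "-5 \<le> g i" "g i \<le> 5" unfolding g_def by linarith+
  qed
  have "(\<Sum>j=1..n. g j) \<le> (\<Sum>j=1..n. 5)" using g by (intro sum_mono) auto
  then have a: "a \<le> 5" using n by (simp add: a_def field_simps)
  have "0 \<le> 1 / n + (g i - a) / (10 * n)" if "i \<in> {1..n}" for i
  proof -
    have "0 \<le> 10 + (g i - a)" using g[OF that] a by linarith
    then have "0 \<le> (10 + (g i - a)) / (10 * n)" by simp
    then show ?thesis using n by (simp add: field_simps)
  qed
  moreover have "(\<Sum>i=1..n. 1 / n + (g i - a) / (10 * n)) = 1"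
  proof -
    have "(\<Sum>i=1..n. g i - a) = 0" using n by (simp add: sum_subtractf a_def)
    then show ?thesis
      using n by (simp add: sum.distrib sum_divide_distrib[symmetric])
  qed
  ultimately show ?thesis by (auto simp: b ballots_def)
qed

text \<open>The constant and the average cancel, and the difference of two tangent lines factors as
  \<open>(p i - p j) * (2 * x - (p i + p j))\<close>. This is affine in \<open>x\<close>, so only
  the sum of the observations matters.\<close>

lemma sum_ballot_diff:
  fixes m n :: nat and p x :: "nat \<Rightarrow> real"
  assumes x: "\<And>v. v < m \<Longrightarrow> x v \<in> {-1..2}" and ij: "i \<in> {1..n}" "j \<in> {1..n}"
  shows "(\<Sum>v<m. ballot n p (x v) i) - (\<Sum>v<m. ballot n p (x v) j) =
         (p i - p j) * (2 * (\<Sum>v<m. x v) - m * (p i + p j)) / (10 * n)"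
proof -
  have "(\<Sum>v<m. ballot n p (x v) i) - (\<Sum>v<m. ballot n p (x v) j) =
        (\<Sum>v<m. (p i - p j) * (2 * x v - (p i + p j)) / (10 * n))"
    unfolding sum_subtractf[symmetric]
  proof (intro sum.cong refl)
    fix v assume "v \<in> {..<m}"
    then have "max (-1) (min 2 (x v)) = x v" using x[of v] by auto
    then have "ballot n p (x v) i - ballot n p (x v) j =
       ((2 * p i * x v - (p i)\<^sup>2) - (2 * p j * x v - (p j)\<^sup>2)) / (10 * n)"
      using ij by (simp add: ballot_def Let_def diff_divide_distrib mult.commute mult.left_commute)
    then show "ballot n p (x v) i - ballot n p (x v) j = (p i - p j) * (2 * x v - (p i + p j)) / (10 * n)"
      by (simp add: algebra_simps power2_eq_square)
  qed
  also have "\<dots> = (p i - p j) * (2 * (\<Sum>v<m. x v) - m * (p i + p j)) / (10 * n)"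
    by (simp add: sum_divide_distrib[symmetric] sum_distrib_left[symmetric] sum_subtractf)
  finally show ?thesis .
qed

text \<open>The second factor compares the sum with \<open>m\<close> times the midpoint of
  \<open>p i\<close> and \<open>p j\<close>. That threshold is at least
  \<open>m * \<epsilon> / 2\<close> away from \<open>m * p i\<close>, so the sum lies on the side of
  urn \<open>i\<close>.\<close>

lemma wins_ballot:
  fixes \<epsilon> :: real and m n :: nat and p x :: "nat \<Rightarrow> real"
  assumes x: "\<And>v. v < m \<Longrightarrow> x v \<in> {-1..2}" and i: "i \<in> {1..n}"
    and gap: "\<And>j. j \<in> {1..n} - {i} \<Longrightarrow> \<epsilon> \<le> \<bar>p i - p j\<bar>"
    and \<epsilon>: "0 < \<epsilon>" and near: "\<bar>(\<Sum>v<m. x v) - m * p i\<bar> < m * \<epsilon> / 2"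
  shows "wins n m (\<lambda>v\<in>{..<m}. ballot n p (x v)) i"
  unfolding wins_def
proof
  fix j assume j: "j \<in> {1..n} - {i}"
  let ?s = "\<Sum>v<m. x v"
  have "0 < (p i - p j) * (2 * ?s - m * (p i + p j))"
  proof (cases "p j < p i")
    case True
    then have "m * \<epsilon> \<le> m * (p i - p j)" using gap[OF j] by (intro mult_left_mono) auto
    then have "0 < 2 * ?s - m * (p i + p j)" using near by (simp add: algebra_simps abs_if split: if_splits)
    then show ?thesis using True by simp
  next
    case False
    then have ne: "p i < p j" using gap[OF j] \<epsilon> by linarith
    then have "m * \<epsilon> \<le> m * (p j - p i)" using gap[OF j] by (intro mult_left_mono) auto
    then have "2 * ?s - m * (p i + p j) < 0" using near by (simp add: algebra_simps abs_if split: if_splits)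
    then show ?thesis using ne by (simp add: mult_neg_neg)
  qed
  then have "0 < (p i - p j) * (2 * ?s - m * (p i + p j)) / (10 * n)" using i by simp
  then have "0 < (\<Sum>v<m. ballot n p (x v) i) - (\<Sum>v<m. ballot n p (x v) j)"
    using j by (subst sum_ballot_diff[OF x i]) auto
  then show "total_score m (\<lambda>v\<in>{..<m}. ballot n p (x v)) j < total_score m (\<lambda>v\<in>{..<m}. ballot n p (x v)) i"
    by (simp add: total_score_def)
qed

section \<open>Transfer from discrete signals to the election measure\<close>

lemma space_ballot_space: "space (ballot_space n) = ballots n"
  by (auto simp: ballot_space_def space_restrict_space space_PiM ballots_def PiE_def)

lemma measurable_ballot_space_component [measurable]:
  "i \<in> {1..n} \<Longrightarrow> (\<lambda>s. s i) \<in> borel_measurable (ballot_space n)"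
  unfolding ballot_space_def by (intro measurable_restrict_space1 measurable_component_singleton)

text \<open>Independent ballots are the image of independent discrete signals. Agreement on boxes
  identifies the product measure, and maps out of a \<open>pmf\<close> raise no measurability
  question beyond landing in the target space.\<close>

lemma PiM_distr_pmf:
  assumes I: "finite I" and f: "f \<in> UNIV \<rightarrow> space M"
  shows "(\<Pi>\<^sub>M v\<in>I. distr (measure_pmf P) M f) =
         distr (measure_pmf (Pi_pmf I d (\<lambda>_. P))) (\<Pi>\<^sub>M v\<in>I. M) (\<lambda>x. \<lambda>v\<in>I. f (x v))"
    (is "_ = ?D")
proof -
  have fm: "f \<in> measurable (measure_pmf P) M" using f by simp
  interpret prob_space "distr (measure_pmf P) M f"
    by (rule measure_pmf.prob_space_distr[OF fm])
  interpret product_prob_space "\<lambda>_. distr (measure_pmf P) M f" I ..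
  have F: "(\<lambda>x. \<lambda>v\<in>I. f (x v)) \<in> measurable (measure_pmf (Pi_pmf I d (\<lambda>_. P))) (\<Pi>\<^sub>M v\<in>I. M)"
    using f by (auto simp: space_PiM)
  show ?thesis
  proof (rule PiM_eqI[symmetric])
    show "sets ?D = sets (\<Pi>\<^sub>M v\<in>I. distr (measure_pmf P) M f)"
      by (simp cong: sets_PiM_cong)
  next
    fix A assume A: "\<And>v. v \<in> I \<Longrightarrow> A v \<in> sets (distr (measure_pmf P) M f)"
    then have "Pi\<^sub>E I A \<in> sets (\<Pi>\<^sub>M v\<in>I. M)" using I by (intro sets_PiM_I_finite) auto
    then have "emeasure ?D (Pi\<^sub>E I A) =
        emeasure (Pi_pmf I d (\<lambda>_. P)) ((\<lambda>x. \<lambda>v\<in>I. f (x v)) -` Pi\<^sub>E I A)"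
      using F by (simp add: emeasure_distr)
    also have "(\<lambda>x. \<lambda>v\<in>I. f (x v)) -` Pi\<^sub>E I A = Pi I (\<lambda>v. f -` A v)"
      by (auto simp: PiE_def Pi_def)
    also have "emeasure (Pi_pmf I d (\<lambda>_. P)) (Pi I (\<lambda>v. f -` A v)) = (\<Prod>v\<in>I. emeasure P (f -` A v))"
      by (simp add: measure_pmf.emeasure_eq_measure measure_Pi_pmf_Pi[OF I] prod_ennreal)
    also have "\<dots> = (\<Prod>v\<in>I. emeasure (distr (measure_pmf P) M f) (A v))"
      using A fm by (intro prod.cong) (auto simp: emeasure_distr)
    finally show "emeasure ?D (Pi\<^sub>E I A) = (\<Prod>v\<in>I. emeasure (distr (measure_pmf P) M f) (A v))" .
  qed (fact I)
qed

definition noisy_scheme :: "nat \<Rightarrow> (nat \<Rightarrow> real) \<Rightarrow> real \<Rightarrow> bool \<Rightarrow> (nat \<Rightarrow> real) measure" where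
  "noisy_scheme n p \<epsilon> c =
     distr (noise_pmf \<epsilon>) (ballot_space n) (\<lambda>z. ballot n p (of_bool c + z))"

context
  fixes n :: nat and p :: "nat \<Rightarrow> real"
  assumes n: "0 < n" and p: "\<And>i. i \<in> {1..n} \<Longrightarrow> p i \<in> {0..1}"
begin

lemma ballot_in_space: "ballot n p x \<in> space (ballot_space n)"
  unfolding space_ballot_space using n p by (rule ballot_in_ballots)

lemma cumulative_voting_scheme_noisy_scheme: "cumulative_voting_scheme n (noisy_scheme n p \<epsilon>)"
  unfolding cumulative_voting_scheme_def noisy_scheme_def
  by (auto intro!: measure_pmf.prob_space_distr simp: ballot_in_space)

text \<open>Averaging over the color merges it with the noise, so a vote is a deterministic function
  of a single signal.\<close>

lemma vote_noisy_scheme: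
  "vote (noisy_scheme n p \<epsilon>) q = distr (signal_pmf \<epsilon> q) (ballot_space n) (ballot n p)"
proof (rule measure_eqI)
  let ?S = "noisy_scheme n p \<epsilon>"
  have S: "?S \<in> measurable (measure_pmf (bernoulli_pmf q)) (subprob_algebra (ballot_space n))"
    using cumulative_voting_scheme_noisy_scheme[of \<epsilon>]
    by (auto simp: cumulative_voting_scheme_def space_subprob_algebra intro: prob_space_imp_subprob_space)
  have b: "ballot n p \<in> measurable (measure_pmf P) (ballot_space n)" for P
    by (simp add: ballot_in_space)
  show sets: "sets (vote ?S q) = sets (distr (signal_pmf \<epsilon> q) (ballot_space n) (ballot n p))"
    unfolding vote_def using S by (simp add: sets_bind[OF sets_kernel[OF S]])
  fix A assume "A \<in> sets (vote ?S q)"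
  then have A: "A \<in> sets (ballot_space n)" by (simp add: sets)
  have "emeasure (vote ?S q) A = (\<integral>\<^sup>+ c. emeasure (?S c) A \<partial>bernoulli_pmf q)"
    unfolding vote_def by (rule emeasure_bind[OF _ S A]) simp
  also have "\<dots> = (\<integral>\<^sup>+ c. emeasure (noise_pmf \<epsilon>) ((\<lambda>z. of_bool c + z) -` ballot n p -` A) \<partial>bernoulli_pmf q)"
    using A by (intro nn_integral_cong)
      (auto simp: noisy_scheme_def emeasure_distr ballot_in_space vimage_def)
  also have "\<dots> = emeasure (signal_pmf \<epsilon> q) (ballot n p -` A)"
    by (simp add: signal_pmf_def add_pmf_def bind_map_pmf)
  also have "\<dots> = emeasure (distr (signal_pmf \<epsilon> q) (ballot_space n) (ballot n p)) A"
    using A b by (simp add: emeasure_distr)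
  finally show "emeasure (vote ?S q) A = emeasure (distr (signal_pmf \<epsilon> q) (ballot_space n) (ballot n p)) A" .
qed

text \<open>Winning is a finite conjunction of comparisons of measurable total scores, so its
  probability can be pulled back to the signals.\<close>

lemma win_prob_noisy_scheme:
  assumes i: "i \<in> {1..n}"
  shows "win_prob n m (noisy_scheme n p \<epsilon>) p i =
    measure_pmf.prob (Pi_pmf {..<m} 0 (\<lambda>_. signal_pmf \<epsilon> (p i)))
      {x. wins n m (\<lambda>v\<in>{..<m}. ballot n p (x v)) i}"
proof -
  let ?E = "\<Pi>\<^sub>M v\<in>{..<m}. ballot_space n"
  have el: "election m (noisy_scheme n p \<epsilon>) (p i) =
      distr (Pi_pmf {..<m} 0 (\<lambda>_. signal_pmf \<epsilon> (p i))) ?E (\<lambda>x. \<lambda>v\<in>{..<m}. ballot n p (x v))"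
    unfolding election_def vote_noisy_scheme
    by (rule PiM_distr_pmf) (auto simp: ballot_in_space)
  have [measurable]: "(\<lambda>b. b v j) \<in> borel_measurable ?E" if "v \<in> {..<m}" "j \<in> {1..n}" for v j
    using measurable_compose[OF measurable_component_singleton[OF that(1)]
        measurable_ballot_space_component[OF that(2)]] by simp
  have ts [measurable]: "(\<lambda>b. total_score m b j) \<in> borel_measurable ?E" if "j \<in> {1..n}" for j
    unfolding total_score_def using that by (intro borel_measurable_sum) measurable
  have "{b \<in> space ?E. wins n m b i} \<in> sets ?E"
    unfolding wins_def
    by (intro sets.sets_Collect_finite_All borel_measurable_less ts) (use i in auto)
  then show ?thesis
    unfolding win_prob_def el
    by (subst measure_distr) (auto simp: space_PiM ballot_in_space vimage_def intro!: arg_cong2[where f = measure])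
qed

lemma win_prob_noisy_scheme_ge:
  assumes i: "i \<in> {1..n}" and m: "0 < m" and \<epsilon>: "0 < \<epsilon>" "\<epsilon> \<le> 1"
    and gap: "\<And>j. j \<in> {1..n} - {i} \<Longrightarrow> \<epsilon> \<le> \<bar>p i - p j\<bar>"
  shows "1 - exp (- (m * \<epsilon>\<^sup>2 / 25000)) \<le> win_prob n m (noisy_scheme n p \<epsilon>) p i"
proof -
  let ?W = "Pi_pmf {..<m} 0 (\<lambda>_. signal_pmf \<epsilon> (p i))"
  have "1 - exp (- (m * \<epsilon>\<^sup>2 / 25000)) \<le>
     measure_pmf.prob (sum_pmf m (signal_pmf \<epsilon> (p i))) {s. \<bar>s - m * p i\<bar> < m * \<epsilon> / 2}"
    by (rule prob_sum_signal[OF \<epsilon> p[OF i] m])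
  also have "\<dots> = measure_pmf.prob ?W {x. \<bar>(\<Sum>v<m. x v) - m * p i\<bar> < m * \<epsilon> / 2}"
    by (subst sum_pmf_conv_Pi_pmf[of _ _ 0]) (simp add: vimage_def)
  also have "\<dots> \<le> measure_pmf.prob ?W {x. wins n m (\<lambda>v\<in>{..<m}. ballot n p (x v)) i}"
  proof (rule measure_pmf.finite_measure_mono_AE)
    \<comment> \<open>On the support the clamp inside \<open>ballot\<close> is inactive, as
      \<open>wins_ballot\<close> requires.\<close>
    have "x v \<in> {-1..2}" if "x \<in> set_pmf ?W" "v < m" for x v
      using that set_pmf_signal_pmf[OF \<epsilon> p[OF i]] by (auto simp: set_Pi_pmf PiE_dflt_def)
    then show "AE x in ?W. x \<in> {x. \<bar>(\<Sum>v<m. x v) - real m * p i\<bar> < real m * \<epsilon> / 2} \<longrightarrow>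
        x \<in> {x. wins n m (\<lambda>v\<in>{..<m}. ballot n p (x v)) i}"
      using wins_ballot[where \<epsilon> = \<epsilon> and p = p, OF _ i gap \<epsilon>(1)] by (auto simp: AE_measure_pmf_iff)
  qed simp
  finally show ?thesis by (simp add: win_prob_noisy_scheme[OF i])
qed

end

section \<open>The minimal gap\<close>

text \<open>The difference telescopes into consecutive gaps: one is at least the minimum and the
  others are positive.\<close>

lemma min_gap_le:
  fixes p :: "nat \<Rightarrow> real"
  assumes mono: "\<And>i. i \<in> {1..n - 1} \<Longrightarrow> p i < p (i + 1)" and ij: "1 \<le> i" "i < j" "j \<le> n"
  shows "min_gap n p \<le> p j - p i"
  using ij(2,3)
proof (induction j)
  case (Suc j)
  have step: "min_gap n p \<le> p (j + 1) - p j" if "i \<le> j"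
    unfolding min_gap_def using that Suc.prems ij(1) by (intro Min_le) auto
  show ?case
  proof (cases "i = j")
    case True
    then show ?thesis using step by simp
  next
    case False
    then have "min_gap n p \<le> p j - p i" using Suc by auto
    moreover have "p j < p (Suc j)" using mono[of j] False Suc.prems ij(1) by auto
    ultimately show ?thesis by linarith
  qed
qed simp

lemma min_gap_pos:
  assumes "2 \<le> n" "\<And>i. i \<in> {1..n - 1} \<Longrightarrow> p i < p (i + 1)"
  shows "0 < min_gap n p"
  unfolding min_gap_def using assms by (subst Min_gr_iff) auto

theorem theorem7:
  "\<exists>C>0. \<forall>(n::nat) (p :: nat \<Rightarrow> real).
     n \<ge> 2 \<and> 0 \<le> p 1 \<and> (\<forall>i\<in>{1..n - 1}. p i < p (i + 1)) \<and> p n \<le> 1 \<longrightarrow>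
     (\<exists>S. cumulative_voting_scheme n S \<and>
        (\<forall>\<eta>::real. 0 < \<eta> \<and> \<eta> < 1 \<longrightarrow>
          (\<forall>m::nat. real m \<ge> C * (1 / (min_gap n p)\<^sup>2) * ln (1 / \<eta>) \<longrightarrow>
            (\<forall>i\<in>{1..n}. win_prob n m S p i \<ge> 1 - \<eta>))))"
proof (rule exI[of _ 25000], intro conjI allI impI)
  fix n :: nat and p :: "nat \<Rightarrow> real"
  assume "n \<ge> 2 \<and> 0 \<le> p 1 \<and> (\<forall>i\<in>{1..n - 1}. p i < p (i + 1)) \<and> p n \<le> 1"
  then have n: "2 \<le> n" and p1: "0 \<le> p 1" and pn: "p n \<le> 1"
    and mono: "\<And>i. i \<in> {1..n - 1} \<Longrightarrow> p i < p (i + 1)" by auto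
  define \<epsilon> where "\<epsilon> = min_gap n p"
  have \<epsilon>: "0 < \<epsilon>" unfolding \<epsilon>_def by (rule min_gap_pos[OF n, of p]) (rule mono)
  have diff: "\<epsilon> \<le> p j - p i" if "1 \<le> i" "i < j" "j \<le> n" for i j
    unfolding \<epsilon>_def by (rule min_gap_le[OF _ that]) (rule mono)
  have p: "p i \<in> {0..1}" if "i \<in> {1..n}" for i
  proof -
    have "p 1 \<le> p i" using diff[of 1 i] \<epsilon> that by (cases "i = 1") auto
    moreover have "p i \<le> p n" using diff[of i n] \<epsilon> that by (cases "i = n") auto
    ultimately show ?thesis using p1 pn by auto
  qed
  have \<epsilon>1: "\<epsilon> \<le> 1" using diff[of 1 n] n p1 pn by auto
  have gap: "\<epsilon> \<le> \<bar>p i - p j\<bar>" if "i \<in> {1..n}" "j \<in> {1..n} - {i}" for i j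
    using diff[of i j] diff[of j i] that by (cases "i < j") auto
  have n0: "0 < n" using n by simp
  show "\<exists>S. cumulative_voting_scheme n S \<and>
        (\<forall>\<eta>::real. 0 < \<eta> \<and> \<eta> < 1 \<longrightarrow>
          (\<forall>m::nat. real m \<ge> 25000 * (1 / (min_gap n p)\<^sup>2) * ln (1 / \<eta>) \<longrightarrow>
            (\<forall>i\<in>{1..n}. win_prob n m S p i \<ge> 1 - \<eta>)))"
  \<comment> \<open>The witness depends on \<open>p\<close> alone, through
    \<open>\<epsilon>\<close>, so one scheme serves all \<open>\<eta>\<close> and
    \<open>m\<close>.\<close>
  proof (rule exI[of _ "noisy_scheme n p \<epsilon>"], intro conjI allI impI ballI)
    show "cumulative_voting_scheme n (noisy_scheme n p \<epsilon>)"
      by (rule cumulative_voting_scheme_noisy_scheme[OF n0 p])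
  next
    fix \<eta> :: real and m i :: nat
    assume \<eta>: "0 < \<eta> \<and> \<eta> < 1" and i: "i \<in> {1..n}"
      and "25000 * (1 / (min_gap n p)\<^sup>2) * ln (1 / \<eta>) \<le> real m"
    then have ln: "ln (1 / \<eta>) \<le> m * \<epsilon>\<^sup>2 / 25000"
      using \<epsilon> by (simp add: \<epsilon>_def field_simps)
    \<comment> \<open>Strictness rules out \<open>m = 0\<close>, where all totals tie at zero and
      nobody wins.\<close>
    moreover have "0 < ln (1 / \<eta>)" using \<eta> by simp
    ultimately have m: "0 < m" by (cases m) auto
    have "exp (- (m * \<epsilon>\<^sup>2 / 25000)) \<le> exp (- ln (1 / \<eta>))" using ln by simp
    also have "\<dots> = \<eta>" using \<eta> by (simp add: ln_div)
    finally show "1 - \<eta> \<le> win_prob n m (noisy_scheme n p \<epsilon>) p i"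
      using win_prob_noisy_scheme_ge[where p = p, OF n0 p i m \<epsilon> \<epsilon>1 gap[OF i]] by linarith
  qed
qed simp

end
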